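(* Let $G=(V,E)$ be a graph, let $D(v)=\deg(G,v)$ for $v\in V$, and let $f,g:V\to\mathbb{N}$ satisfy $f(v)\leq g(v)\leq D(v)$ for all $v\in V$. For each $v\in V$ write $g(v)-f(v)=2a_v+b_v$ with $a_v,b_v$ integers and $0\leq b_v\leq 1$, and define $$q_v(y)=y^{f(v)}(1+y)^{b_v}(1+\sqrt{3}\,y+y^2)^{a_v}.$$ Assign nonnegative fugacities $\mathbf{u}^{(v)}=\{u^{(v)}_0,u^{(v)}_1,\ldots\}$ to each $v\in V$ so that the polynomial $$\Gamma(D(v),\mathbf{u}^{(v)},y):=\sum_{k=0}^{D(v)}\binom{D(v)}{k}u^{(v)}_k y^k$$ is the coefficientwise product of $(1+y)^{D(v)}$ and $q_v(y)$; that is, $u^{(v)}_k$ is the coefficient of $y^k$ in $q_v(y)$ for $0\leq k\leq D(v)$. Then the polynomial $\sum_j N(G;\{\mathbf{u}^{(v)}\},j)\,t^j$ is $\mathcal{S}[2\pi/3]$-nonvanishing. Therefore, the coefficients $\{N(G;\{\mathbf{u}^{(v)}\},j)\}$ are logarithmically concave: for all $j\geq 1$, $$N(G;\{\mathbf{u}^{(v)}\},j)^2\geq N(G;\{\mathbf{u}^{(v)}\},j-1)\,N(G;\{\mathbf{u}^{(v)}\},j+1).$$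
   Context: A graph $G=(V,E)$ is a finite undirected multigraph (loops and multiple edges allowed); $\mathbb{N}$ includes $0$. Spanning subgraphs are identified with edge subsets $H\subseteq E$; $\deg(H,v)$ is the degree of $v$ in $(V,H)$, a loop contributing $2$, and $\deg(G,v)=\deg(E,v)$. For $H\subseteq E$, $\mathbf{u}_{\deg(H)}:=\prod_{v\in V}u^{(v)}_{\deg(H,v)}$, and for $j\in\mathbb{N}$, $N(G;\{\mathbf{u}^{(v)}\},j):=\sum_{H\subseteq E:\ \#H=j}\mathbf{u}_{\deg(H)}$. A univariate complex polynomial $F$ is $\mathcal{S}[\theta]$-nonvanishing if either $F\equiv 0$, or $F(z)\neq 0$ for all $z\in\mathcal{S}[\theta]:=\{z\in\mathbb{C}: z\neq 0 \text{ and } |\arg(z)|<\theta\}$, with $-\pi<\arg(z)\leq\pi$. *)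

theory Defs
  imports
    "HOL-Analysis.Analysis"
    "HOL-Computational_Algebra.Polynomial"
    "HOL-Library.Multiset"
begin

text \<open>
  Each edge carries the two-element multiset of its endpoints: distinct edges may have the
  same endpoints, and a loop at \<open>v\<close> has endpoints \<open>{#v, v#}\<close>, so that it counts twice
  towards the degree of \<open>v\<close>.
\<close>

record ('v, 'e) mgraph =
  verts :: "'v set"
  edges :: "'e set"
  ends :: "'e \<Rightarrow> 'v multiset"

locale multigraph =
  fixes G :: "('v, 'e) mgraph"
  assumes finite_verts: "finite (verts G)"
    and finite_edges: "finite (edges G)"
    and size_ends: "e \<in> edges G \<Longrightarrow> size (ends G e) = 2"
    and ends_subset: "e \<in> edges G \<Longrightarrow> set_mset (ends G e) \<subseteq> verts G"

definition deg_in :: "('v, 'e) mgraph \<Rightarrow> 'e set \<Rightarrow> 'v \<Rightarrow> nat" where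
  "deg_in G H v = (\<Sum>e\<in>H. count (ends G e) v)"

definition deg :: "('v, 'e) mgraph \<Rightarrow> 'v \<Rightarrow> nat" where
  "deg G v = deg_in G (edges G) v"

definition u_deg :: "('v, 'e) mgraph \<Rightarrow> ('v \<Rightarrow> nat \<Rightarrow> real) \<Rightarrow> 'e set \<Rightarrow> real" where
  "u_deg G u H = (\<Prod>v\<in>verts G. u v (deg_in G H v))"

definition N :: "('v, 'e) mgraph \<Rightarrow> ('v \<Rightarrow> nat \<Rightarrow> real) \<Rightarrow> nat \<Rightarrow> real" where
  "N G u j = (\<Sum>H | H \<subseteq> edges G \<and> card H = j. u_deg G u H)"

text \<open>Terms with \<open>j > card (edges G)\<close> vanish, see \<open>coeff_N_poly\<close> below.\<close>

definition N_poly :: "('v, 'e) mgraph \<Rightarrow> ('v \<Rightarrow> nat \<Rightarrow> real) \<Rightarrow> complex poly" where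
  "N_poly G u = (\<Sum>j\<le>card (edges G). monom (of_real (N G u j)) j)"

definition \<Gamma> :: "nat \<Rightarrow> (nat \<Rightarrow> real) \<Rightarrow> real poly" where
  "\<Gamma> d w = (\<Sum>k\<le>d. monom (real (d choose k) * w k) k)"

definition coeffwise_prod :: "real poly \<Rightarrow> real poly \<Rightarrow> real poly" where
  "coeffwise_prod p q =
     (\<Sum>k\<le>max (degree p) (degree q). monom (coeff p k * coeff q k) k)"

definition q_poly :: "nat \<Rightarrow> nat \<Rightarrow> nat \<Rightarrow> real poly" where
  "q_poly f a b = monom 1 f * [:1, 1:] ^ b * [:1, sqrt 3, 1:] ^ a"

text \<open>\<^const>\<open>Arg\<close> takes values in \<open>(-\<pi>, \<pi>]\<close>.\<close>

definition sector :: "real \<Rightarrow> complex set" where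
  "sector \<theta> = {z. z \<noteq> 0 \<and> \<bar>Arg z\<bar> < \<theta>}"

definition sector_nonvanishing :: "real \<Rightarrow> complex poly \<Rightarrow> bool" where
  "sector_nonvanishing \<theta> F \<longleftrightarrow> F = 0 \<or> (\<forall>z\<in>sector \<theta>. poly F z \<noteq> 0)"

lemma coeff_coeffwise_prod: "coeff (coeffwise_prod p q) k = coeff p k * coeff q k"
  by (auto simp: coeffwise_prod_def coeff_sum coeff_monom coeff_eq_0 not_le)

lemma coeff_\<Gamma>: "coeff (\<Gamma> d w) k = real (d choose k) * w k"
  by (auto simp: \<Gamma>_def coeff_sum coeff_monom not_le)

lemma \<Gamma>_eq_coeffwise_prod_iff:
  "\<Gamma> d w = coeffwise_prod ([:1, 1:] ^ d) q \<longleftrightarrow> (\<forall>k\<le>d. w k = coeff q k)"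
proof -
  have c: "coeff ([:1, 1:] ^ d) k = real (d choose k)" for k
  proof (cases "k \<le> d")
    case True
    then show ?thesis
      by (simp add: coeff_linear_poly_power)
  next
    case False
    then show ?thesis
      by (simp add: coeff_eq_0 degree_linear_power binomial_eq_0)
  qed
  have "real (d choose k) * w k = real (d choose k) * coeff q k \<longleftrightarrow> (k \<le> d \<longrightarrow> w k = coeff q k)" for k
    by (cases "k \<le> d") (simp_all add: binomial_eq_0)
  then show ?thesis
    by (simp add: poly_eq_iff coeff_\<Gamma> coeff_coeffwise_prod c)
qed

lemma coeff_N_poly:
  assumes "finite (edges G)"
  shows "coeff (N_poly G u) j = of_real (N G u j)"
proof -
  have "N G u j = 0" if "j > card (edges G)"
  proof -
    have "{H. H \<subseteq> edges G \<and> card H = j} = {}"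
      using assms that card_mono by (metis (mono_tags, lifting) empty_Collect_eq not_le)
    then show ?thesis
      unfolding N_def by (simp only: sum.empty)
  qed
  then show ?thesis
    by (auto simp: N_poly_def coeff_sum coeff_monom not_le)
qed

end

theory Submission
  imports Defs
    "HOL-Complex_Analysis.Great_Picard"
    "HOL-Computational_Algebra.Fundamental_Theorem_Algebra"
begin

text \<open>
  Put \<open>t = s\<^sup>2\<close> with \<open>\<bar>Arg s\<bar> < \<pi>/3\<close>, and let \<open>m\<^sub>v = g v - f v\<close>, \<open>r\<^sub>v(y) = q\<^sub>v(y) / y\<^bsup>f v\<^esup>\<close>.
  Since \<open>u\<^sub>k\<close> is a coefficient of \<open>q\<^sub>v\<close>, the sum \<open>\<Sum>\<^sub>j N\<^sub>j t\<^sup>j\<close> is, up to a power of \<open>s\<close>, the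
  coefficient of \<open>\<Prod>\<^sub>v z\<^sub>v\<^bsup>g v\<^esup>\<close> in
  \<open>(\<Prod>\<^sub>v z\<^sub>v\<^bsup>m\<^sub>v\<^esup> r\<^sub>v(s / z\<^sub>v)) (\<Prod>\<^bsub>e = vw\<^esub> (1 + z\<^sub>v z\<^sub>w))\<close>.
  The vertex factors split into \<open>z + s\<close> and \<open>z + e\<^bsup>\<plusminus>i\<pi>/6\<^esup> s\<close>, so the whole product has no zero when
  all \<open>z\<^sub>v\<close> lie in the open right half-plane. Extracting the coefficient in one variable after the
  other preserves nonvanishing: by Gauss-Lucas all derivatives of a polynomial without zeros in the
  right half-plane have none there either, and Hurwitz' theorem on complex lines allows the passage
  to the boundary point \<open>z\<^sub>v = 0\<close>. The domain of \<open>s\<close> is convex, unlike that of \<open>t\<close>.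

  For the log-concavity, the roots of the resulting real polynomial lie outside the sector, so it is
  a product of factors \<open>x + a\<close> and \<open>x\<^sup>2 + a x + b\<close> with \<open>0 \<le> a\<close> and \<open>0 \<le> b \<le> a\<^sup>2\<close>, and
  multiplication by these preserves log-concavity.
\<close>

section \<open>Coefficients of half-plane nonvanishing polynomials\<close>

lemma poly_eq_sum_of_degree_le:
  fixes x :: "'a :: comm_semiring_1"
  shows "degree p \<le> n \<Longrightarrow> poly p x = (\<Sum>i\<le>n. coeff p i * x ^ i)"
  unfolding poly_altdef by (rule sum.mono_neutral_left) (auto simp: coeff_eq_0)


text \<open>Peeling off roots one at a time writes the logarithmic derivative at \<open>y\<close> as
  the sum of \<open>1 / (y - r)\<close> over the roots \<open>r\<close>. Each root has
  \<open>Re r \<le> 0\<close>, so every summand has positive real part, and a single root gives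
  strictness.\<close>

lemma Re_pderiv_div_poly:
  fixes p :: "complex poly"
  assumes "\<And>z. Re z > 0 \<Longrightarrow> poly p z \<noteq> 0" and "Re y > 0"
  shows "Re (poly (pderiv p) y / poly p y) \<ge> 0
       \<and> (degree p > 0 \<longrightarrow> Re (poly (pderiv p) y / poly p y) > 0)"
  using assms(1)
proof (induction "degree p" arbitrary: p)
  case 0
  then obtain c where "p = [:c:]"
    by (metis degree_eq_zeroE)
  then show ?case
    by (simp add: pderiv_pCons)
next
  case (Suc n)
  then have "\<not> constant (poly p)"
    using constant_degree by (metis nat.distinct(1))
  then obtain r where "poly p r = 0"
    using fundamental_theorem_of_algebra by blast
  then obtain q where p: "p = [:- r, 1:] * q"
    by (auto simp: poly_eq_0_iff_dvd)
  have r: "Re r \<le> 0"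
    using Suc.prems \<open>poly p r = 0\<close> by force
  have q: "poly q z \<noteq> 0" if "Re z > 0" for z
    using Suc.prems[OF that] p by auto
  have "q \<noteq> 0"
    using q[of 1] by auto
  then have "degree q = n"
    using Suc.hyps(2) unfolding p by (subst (asm) degree_mult_eq) auto
  then have IH: "Re (poly (pderiv q) y / poly q y) \<ge> 0"
    using Suc.hyps(1)[of q] q by blast
  have ne: "y - r \<noteq> 0" "poly q y \<noteq> 0"
    using r q assms(2) by auto
  have "poly (pderiv p) y = (y - r) * poly (pderiv q) y + poly q y" "poly p y = (y - r) * poly q y"
    unfolding p pderiv_mult by (simp_all add: pderiv_pCons algebra_simps)
  then have "poly (pderiv p) y / poly p y = 1 / (y - r) + poly (pderiv q) y / poly q y"
    using ne by (simp add: add_divide_distrib)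
  moreover have "Re (1 / (y - r)) > 0"
  proof -
    have "Re (y - r) > 0"
      using r assms(2) by simp
    moreover have "(Re (y - r))\<^sup>2 + (Im (y - r))\<^sup>2 > 0"
      using calculation by (simp add: add_pos_nonneg)
    ultimately show ?thesis
      by (simp add: Re_divide del: minus_complex.sel)
  qed
  ultimately show ?case
    using IH by simp
qed

text \<open>Iterated Gauss-Lucas for the right half-plane. The bound on \<open>k\<close> keeps every
  polynomial being differentiated nonconstant, so the strict inequality for the logarithmic
  derivative applies.\<close>

lemma higher_pderiv_nonvanishing:
  fixes p :: "complex poly"
  assumes "\<And>z. Re z > 0 \<Longrightarrow> poly p z \<noteq> 0" and "k \<le> degree p" and "Re y > 0"
  shows "poly ((pderiv ^^ k) p) y \<noteq> 0"
  using assms(2,3)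
proof (induction k arbitrary: y)
  case 0
  then show ?case
    using assms(1) by simp
next
  case (Suc k)
  let ?q = "(pderiv ^^ k) p"
  have nz: "poly ?q z \<noteq> 0" if "Re z > 0" for z
    using Suc.IH[of z] Suc.prems(1) that by simp
  have "degree ?q > 0"
    using Suc.prems(1) by (simp add: degree_higher_pderiv)
  then have "Re (poly (pderiv ?q) y / poly ?q y) > 0"
    using Re_pderiv_div_poly[of ?q y] nz Suc.prems(2) by blast
  then show ?case
    by auto
qed

text \<open>Evaluating at \<open>1 / (n + 1)\<close> gives zero-free holomorphic functions of
  \<open>x\<close> converging to the constant coefficient, uniformly on compact sets. By Hurwitz the
  limit is zero-free or identically zero, and \<open>x0\<close> excludes the latter.\<close>

lemma constant_coeff_zero_or_nonvanishing:
  fixes p :: "complex \<Rightarrow> complex poly"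
  assumes U: "open U" "connected U"
    and deg: "\<And>x. x \<in> U \<Longrightarrow> degree (p x) \<le> d"
    and hol: "\<And>k. (\<lambda>x. coeff (p x) k) holomorphic_on U"
    and nz: "\<And>x y. x \<in> U \<Longrightarrow> y > 0 \<Longrightarrow> poly (p x) (of_real y) \<noteq> 0"
    and "x0 \<in> U" "coeff (p x0) 0 \<noteq> 0" "x1 \<in> U"
  shows "coeff (p x1) 0 \<noteq> 0"
proof (cases "(\<lambda>x. coeff (p x) 0) constant_on U")
  case True
  then show ?thesis
    using assms(6-8) by (auto simp: constant_on_def)
next
  case False
  \<comment> \<open>The uniform degree bound \<open>d\<close> makes this a sum of fixed length, so
    convergence can be checked term by term.\<close>
  define F where "F = (\<lambda>n x. \<Sum>k\<le>d. coeff (p x) k * of_real (inverse (real (Suc n))) ^ k)"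
  have F: "F n x = poly (p x) (of_real (inverse (real (Suc n))))" if "x \<in> U" for n x
    unfolding F_def by (rule poly_eq_sum_of_degree_le[OF deg[OF that], symmetric])
  show ?thesis
  proof (rule Hurwitz_no_zeros[OF U, of F "\<lambda>x. coeff (p x) 0"])
    show "F n holomorphic_on U" for n
      unfolding F_def by (intro holomorphic_intros hol)
    show "F n z \<noteq> 0" if "z \<in> U" for n z
      using nz[OF that, of "inverse (real (Suc n))"] F[OF that] by simp
    show "uniform_limit K F (\<lambda>x. coeff (p x) 0) sequentially" if K: "compact K" "K \<subseteq> U" for K
    proof -
      have *: "uniform_limit K (\<lambda>n x. coeff (p x) k * of_real (inverse (real (Suc n))) ^ k)
                (\<lambda>x. coeff (p x) k * (0::complex) ^ k) sequentially" for k
      proof (rule uniform_lim_mult)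
        show "uniform_limit K (\<lambda>n x. of_real (inverse (real (Suc n))) ^ k) (\<lambda>x. (0::complex) ^ k) sequentially"
        proof (rule uniform_limitI)
          fix e :: real
          assume "e > 0"
          have "(\<lambda>n. of_real (inverse (real (Suc n)))) \<longlonglongrightarrow> (0 :: complex)"
            using LIMSEQ_inverse_real_of_nat by (subst of_real_0[symmetric], intro tendsto_of_real)
          then have "(\<lambda>n. of_real (inverse (real (Suc n))) ^ k) \<longlonglongrightarrow> (0::complex) ^ k"
            by (rule tendsto_power)
          from tendstoD[OF this \<open>e > 0\<close>]
          show "\<forall>\<^sub>F n in sequentially. \<forall>x\<in>K. dist (of_real (inverse (real (Suc n))) ^ k) ((0::complex) ^ k) < e"
            by (rule eventually_mono) blast
        qed
        have "continuous_on K (\<lambda>x. coeff (p x) k)"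
          using hol[of k] K(2) holomorphic_on_imp_continuous_on continuous_on_subset by blast
        then show "bounded ((\<lambda>x. coeff (p x) k) ` K)"
          using K(1) compact_continuous_image compact_imp_bounded by blast
        show "bounded ((\<lambda>x. (0::complex) ^ k) ` K)"
          by (rule bounded_subset[of "{0 ^ k}"]) auto
      qed (rule uniform_limit_const)
      have "uniform_limit K (\<lambda>n x. \<Sum>k\<le>e. coeff (p x) k * of_real (inverse (real (Suc n))) ^ k)
              (\<lambda>x. \<Sum>k\<le>e. coeff (p x) k * (0::complex) ^ k) sequentially" for e
      proof (induction e)
        case 0
        show ?case
          using *[of 0] by simp
      next
        case (Suc e)
        then show ?case
          unfolding sum.atMost_Suc by (intro uniform_limit_add *)
      qed
      then have "uniform_limit K F (\<lambda>x. \<Sum>k\<le>d. coeff (p x) k * (0::complex) ^ k) sequentially"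
        unfolding F_def .
      moreover have "(\<Sum>k\<le>d. coeff (p x) k * (0::complex) ^ k) = coeff (p x) 0" for x
        by (simp add: power_0_left if_distrib[of "\<lambda>u. _ * u"] sum.delta cong: if_cong)
      ultimately show ?thesis
        by simp
    qed
  qed (use False hol assms(8) in auto)
qed

text \<open>Up to the factor \<open>m!\<close> the coefficient is the constant coefficient of the
  \<open>m\<close>-th derivative, which Gauss-Lucas keeps zero-free. This needs \<open>m\<close> to
  be at most the degree at every point, so the degree is first shown to be constant on
  \<open>U\<close>.\<close>

lemma coeff_zero_or_nonvanishing:
  fixes p :: "complex \<Rightarrow> complex poly"
  assumes U: "open U" "connected U"
    and deg: "\<And>x. x \<in> U \<Longrightarrow> degree (p x) \<le> d"
    and hol: "\<And>k. (\<lambda>x. coeff (p x) k) holomorphic_on U"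
    and nz: "\<And>x y. x \<in> U \<Longrightarrow> Re y > 0 \<Longrightarrow> poly (p x) y \<noteq> 0"
    and x0: "x0 \<in> U" "coeff (p x0) m \<noteq> 0" and x1: "x1 \<in> U"
  shows "coeff (p x1) m \<noteq> 0"
proof -
  define P where "P = (\<lambda>k. \<exists>x\<in>U. coeff (p x) k \<noteq> 0)"
  have P_le: "k \<le> d" if "P k" for k
    using that deg le_degree order_trans unfolding P_def by blast
  have "P m"
    using x0 unfolding P_def by blast
  \<comment> \<open>The generic degree: the largest index whose coefficient is not identically zero
    on \<open>U\<close>.\<close>
  define n where "n = (GREATEST k. P k)"
  have "P n"
    unfolding n_def using \<open>P m\<close> P_le by (rule GreatestI_nat) 
  have le_n: "k \<le> n" if "P k" for k
    unfolding n_def using that P_le by (rule Greatest_le_nat)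
  have deg_n: "degree (p x) \<le> n" if "x \<in> U" for x
    by (rule degree_le) (use le_n that in \<open>force simp: P_def\<close>)
  \<comment> \<open>The leading coefficient is the constant coefficient of the reversed polynomial.\<close>
  have lead: "coeff (p x) n \<noteq> 0" if "x \<in> U" for x
  proof -
    define r where "r = (\<lambda>x. \<Sum>i\<le>n. monom (coeff (p x) i) (n - i))"
    have cr: "coeff (r x) k = (if k \<le> n then coeff (p x) (n - k) else 0)" for x k
    proof -
      have "coeff (r x) k = (\<Sum>i\<le>n. if i = n - k \<and> k \<le> n then coeff (p x) i else 0)"
        unfolding r_def coeff_sum coeff_monom by (rule sum.cong) auto
      then show ?thesis
        by (auto simp: sum.delta)
    qed
    have poly_r: "poly (r x) y = y ^ n * poly (p x) (inverse y)" if "x \<in> U" "y \<noteq> 0" for x y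
    proof -
      have "y ^ n * poly (p x) (inverse y) = (\<Sum>i\<le>n. coeff (p x) i * y ^ (n - i))"
        unfolding poly_eq_sum_of_degree_le[OF deg_n[OF that(1)]] sum_distrib_left
        by (rule sum.cong) (use that in \<open>auto simp: field_simps power_diff\<close>)
      then show ?thesis
        by (simp add: r_def poly_sum poly_monom)
    qed
    obtain x' where "x' \<in> U" "coeff (p x') n \<noteq> 0"
      using \<open>P n\<close> unfolding P_def by blast
    then have "coeff (r x) 0 \<noteq> 0"
      using that
    proof (intro constant_coeff_zero_or_nonvanishing[OF U, of r n x' x])
      show "degree (r x) \<le> n" for x
        by (rule degree_le) (simp add: cr)
      show "(\<lambda>x. coeff (r x) k) holomorphic_on U" for k
        using hol by (cases "k \<le> n") (simp_all add: cr)
      \<comment> \<open>Reversal replaces \<open>y\<close> by its inverse, which stays on the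
        positive axis.\<close>
      show "poly (r x) (of_real y) \<noteq> 0" if "x \<in> U" "y > 0" for x y
        using that nz[of x "of_real (inverse y)"] by (simp add: poly_r)
    qed (auto simp: cr)
    then show ?thesis
      by (simp add: cr)
  qed
  have deg_eq: "degree (p x) = n" if "x \<in> U" for x
    using deg_n[OF that] lead[OF that] le_degree by (metis le_antisym)
  have "m \<le> n"
    using le_n \<open>P m\<close> .
  define q where "q = (\<lambda>x. (pderiv ^^ m) (p x))"
  have cq: "coeff (q x) k = pochhammer (of_nat (Suc k)) m * coeff (p x) (k + m)" for x k
    unfolding q_def by (simp add: coeff_higher_pderiv add.commute)
  have "coeff (q x1) 0 \<noteq> 0"
  proof (rule constant_coeff_zero_or_nonvanishing[OF U, of q d x0 x1])
    show "degree (q x) \<le> d" if "x \<in> U" for x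
      using deg[OF that] by (simp add: q_def degree_higher_pderiv)
    show "(\<lambda>x. coeff (q x) k) holomorphic_on U" for k
      unfolding cq by (intro holomorphic_intros hol)
    show "poly (q x) (of_real y) \<noteq> 0" if "x \<in> U" "y > 0" for x y
      unfolding q_def
      by (rule higher_pderiv_nonvanishing) (use nz that deg_eq \<open>m \<le> n\<close> in auto)
    show "coeff (q x0) 0 \<noteq> 0"
      using x0 by (simp add: cq pochhammer_fact[symmetric])
  qed (use x0 x1 in auto)
  then show ?thesis
    by (simp add: cq)
qed

section \<open>Coefficient extraction in several variables\<close>

lemma poly_eq_0_if_zero_on_positive_reals:
  fixes p :: "complex poly"
  assumes "\<And>x. x > 0 \<Longrightarrow> poly p (of_real x) = 0"
  shows "p = 0"
proof (rule ccontr)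
  assume "p \<noteq> 0"
  then have "finite {z. poly p z = 0}"
    by (rule poly_roots_finite)
  moreover have "of_real ` {0<..} \<subseteq> {z. poly p z = 0}"
    using assms by auto
  ultimately have "finite (complex_of_real ` {0<..})"
    using finite_subset by blast
  then have "finite {0::real<..}"
    by (rule finite_imageD) (auto simp: inj_on_def)
  then show False
    using infinite_Ioi by blast
qed

lemma affine_vimage_open_convex:
  fixes a b :: complex
  assumes "open S" "convex S"
  shows "open ((\<lambda>l. a + l * b) -` S)" "convex ((\<lambda>l. a + l * b) -` S)"
proof -
  show "open ((\<lambda>l. a + l * b) -` S)"
    by (intro open_vimage assms continuous_intros)
  show "convex ((\<lambda>l. a + l * b) -` S)"
  proof (rule convexI)
    fix x y :: complex and u v :: real
    assume xy: "x \<in> (\<lambda>l. a + l * b) -` S" "y \<in> (\<lambda>l. a + l * b) -` S"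
      and uv: "0 \<le> u" "0 \<le> v" "u + v = 1"
    then have "u *\<^sub>R (a + x * b) + v *\<^sub>R (a + y * b) \<in> S"
      using convexD[OF assms(2) _ _ uv] xy by simp
    moreover have "u *\<^sub>R (a + x * b) + v *\<^sub>R (a + y * b) = (u + v) *\<^sub>R a + (u *\<^sub>R x + v *\<^sub>R y) * b"
      by (simp add: algebra_simps)
    ultimately show "u *\<^sub>R x + v *\<^sub>R y \<in> (\<lambda>l. a + l * b) -` S"
      using uv(3) by simp
  qed
qed

text \<open>
  The coefficient of \<open>\<Prod>v\<in>W. z v ^ g v\<close> in \<open>\<Sum>h\<in>A. \<Prod>v\<in>V. poly (R h v s) (z v)\<close>.
\<close>

definition extracted ::
  "'h set \<Rightarrow> 'v set \<Rightarrow> ('h \<Rightarrow> 'v \<Rightarrow> complex \<Rightarrow> complex poly) \<Rightarrow> ('v \<Rightarrow> nat) \<Rightarrow> 'v set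
    \<Rightarrow> complex \<Rightarrow> ('v \<Rightarrow> complex) \<Rightarrow> complex" where
  "extracted A V R g W s z =
    (\<Sum>h\<in>A. (\<Prod>v\<in>W. coeff (R h v s) (g v)) * (\<Prod>v\<in>V - W. poly (R h v s) (z v)))"

text \<open>Induction on \<open>W\<close>, one variable at a time. A coefficient may vanish
  identically, so both alternatives are carried along. In the second one, two parameter points are
  compared on the complex line through them, where the one-variable result applies.\<close>

lemma extract_zero_or_nonvanishing:
  fixes R :: "'h \<Rightarrow> 'v \<Rightarrow> complex \<Rightarrow> complex poly"
  assumes fin: "finite A" "finite V"
    and \<Omega>: "open \<Omega>" "convex \<Omega>"
    and deg: "\<And>h v s. degree (R h v s) \<le> d h v"
    and hol: "\<And>h v k. (\<lambda>s. coeff (R h v s) k) holomorphic_on \<Omega>"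
    and nz: "\<And>s z. s \<in> \<Omega> \<Longrightarrow> (\<And>v. v \<in> V \<Longrightarrow> Re (z v) > 0) \<Longrightarrow> extracted A V R g {} s z \<noteq> 0"
    and "W \<subseteq> V"
  shows "(\<forall>s\<in>\<Omega>. \<forall>z. (\<forall>v\<in>V. Re (z v) > 0) \<longrightarrow> extracted A V R g W s z = 0)
       \<or> (\<forall>s\<in>\<Omega>. \<forall>z. (\<forall>v\<in>V. Re (z v) > 0) \<longrightarrow> extracted A V R g W s z \<noteq> 0)"
  using finite_subset[OF \<open>W \<subseteq> V\<close> fin(2)] \<open>W \<subseteq> V\<close>
proof (induction W rule: finite_induct)
  case empty
  then show ?case
    using nz by blast
next
  case (insert v W)
  define c where "c = (\<lambda>s z h. (\<Prod>w\<in>W. coeff (R h w s) (g w))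
    * (\<Prod>w\<in>V - insert v W. poly (R h w s) (z w)))"
  \<comment> \<open>The current sum as a polynomial in the variable of \<open>v\<close> alone; its
    coefficient at \<open>g v\<close> is the next extraction.\<close>
  define P where "P = (\<lambda>s z. \<Sum>h\<in>A. smult (c s z h) (R h v s))"
  have coeff_P: "coeff (P s z) k = (\<Sum>h\<in>A. c s z h * coeff (R h v s) k)" for s z k
    by (simp add: P_def coeff_sum)
  have V: "V - W = insert v (V - insert v W)"
    using insert.hyps insert.prems by auto
  have poly_P: "poly (P s z) y = extracted A V R g W s (z(v := y))" for s z y
  proof -
    have "(\<Prod>w\<in>V - insert v W. poly (R h w s) ((z(v := y)) w))
        = (\<Prod>w\<in>V - insert v W. poly (R h w s) (z w))" for h
      by (rule prod.cong) auto
    then show ?thesis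
      unfolding P_def extracted_def c_def V
      using fin(2) by (simp add: poly_sum mult_ac del: fun_upd_apply) (simp add: mult_ac)
  qed
  have extract_P: "extracted A V R g (insert v W) s z = coeff (P s z) (g v)" for s z
    unfolding coeff_P extracted_def c_def
    using insert.hyps by (simp add: mult_ac)
  from insert.IH insert.prems consider
      (zero) "\<forall>s\<in>\<Omega>. \<forall>z. (\<forall>v\<in>V. Re (z v) > 0) \<longrightarrow> extracted A V R g W s z = 0"
    | (nonzero) "\<forall>s\<in>\<Omega>. \<forall>z. (\<forall>v\<in>V. Re (z v) > 0) \<longrightarrow> extracted A V R g W s z \<noteq> 0"
    by blast
  then show ?case
  proof cases
    case zero
    have "P s z = 0" if "s \<in> \<Omega>" "\<forall>v\<in>V. Re (z v) > 0" for s z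
      by (rule poly_eq_0_if_zero_on_positive_reals) (use zero that in \<open>auto simp: poly_P\<close>)
    then show ?thesis
      by (simp add: extract_P)
  next
    case nonzero
    have "coeff (P s1 z1) (g v) \<noteq> 0"
      if 0: "s0 \<in> \<Omega>" "\<forall>v\<in>V. Re (z0 v) > 0" "coeff (P s0 z0) (g v) \<noteq> 0"
        and 1: "s1 \<in> \<Omega>" "\<forall>v\<in>V. Re (z1 v) > 0" for s0 z0 s1 z1
    proof -
      \<comment> \<open>\<open>l = 0\<close> and \<open>l = 1\<close> give the two points. Convexity
        of \<open>\<Omega>\<close> and of the half-plane makes the admissible \<open>l\<close> a
        convex, hence connected, domain.\<close>
      define s where "s = (\<lambda>l. s0 + l * (s1 - s0))"
      define z where "z = (\<lambda>l v. z0 v + l * (z1 v - z0 v))"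
      define U where "U = s -` \<Omega> \<inter> (\<Inter>v\<in>V. (\<lambda>l. z l v) -` {x. Re x > 0})"
      have U: "open U" "convex U"
        unfolding U_def s_def z_def
        by (intro open_Int open_INT convex_Int convex_INT affine_vimage_open_convex \<Omega> fin ballI
            open_halfspace_Re_gt convex_halfspace_Re_gt)+
      have hol_s: "(\<lambda>l. coeff (R h w (s l)) k) holomorphic_on U" for h w k
      proof -
        have "s holomorphic_on U"
          unfolding s_def by (intro holomorphic_intros)
        then show ?thesis
          using holomorphic_on_compose_gen[of s U "\<lambda>s. coeff (R h w s) k" \<Omega>] hol
          by (auto simp: o_def U_def)
      qed
      have hol_poly: "(\<lambda>l. poly (R h w (s l)) (z l w)) holomorphic_on U" for h w
        unfolding poly_eq_sum_of_degree_le[OF deg[of h w]] z_def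
        by (intro holomorphic_intros hol_s)
      have "coeff (P (s 1) (z 1)) (g v) \<noteq> 0"
      proof (rule coeff_zero_or_nonvanishing[of U "\<lambda>l. P (s l) (z l)" "\<Sum>h\<in>A. d h v" 0 _ 1])
        show "connected U"
          using U(2) by (rule convex_connected)
        show "degree (P (s l) (z l)) \<le> (\<Sum>h\<in>A. d h v)" for l
          unfolding P_def
        proof (rule degree_sum_le[OF fin(1)])
          fix h assume "h \<in> A"
          then have "d h v \<le> (\<Sum>h\<in>A. d h v)"
            using fin(1) by (intro member_le_sum) auto
          then show "degree (smult (c (s l) (z l) h) (R h v (s l))) \<le> (\<Sum>h\<in>A. d h v)"
            by (rule order_trans[OF degree_smult_le order_trans[OF deg]])
        qed
        show "(\<lambda>l. coeff (P (s l) (z l)) k) holomorphic_on U" for k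
          unfolding coeff_P c_def by (intro holomorphic_intros hol_s hol_poly)
        show "poly (P (s l) (z l)) y \<noteq> 0" if "l \<in> U" "Re y > 0" for l y
          using nonzero that by (auto simp: poly_P U_def)
      qed (use U(1) 0 1 in \<open>auto simp: s_def z_def U_def\<close>)
      then show ?thesis
        by (simp add: s_def z_def)
    qed
    then show ?thesis
      unfolding extract_P by blast
  qed
qed

section \<open>Log-concave polynomials\<close>

text \<open>Integer indices avoid truncated subtraction when a shift such as \<open>m - 2\<close>
  leaves the range.\<close>

definition icoeff :: "real poly \<Rightarrow> int \<Rightarrow> real" where
  "icoeff p k = (if k < 0 then 0 else coeff p (nat k))"

text \<open>
  Stronger than the inequality for adjacent coefficients: internal zeros are excluded, without which
  products need not stay log-concave.
\<close>

definition log_concave :: "real poly \<Rightarrow> bool" where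
  "log_concave p \<longleftrightarrow> (\<forall>w x y z. w \<le> x \<longrightarrow> w \<le> y \<longrightarrow> w + z = x + y \<longrightarrow>
     icoeff p w * icoeff p z \<le> icoeff p x * icoeff p y)"

lemma log_concaveD:
  "log_concave p \<Longrightarrow> w \<le> x \<Longrightarrow> w \<le> y \<Longrightarrow> w + z = x + y \<Longrightarrow>
     icoeff p w * icoeff p z \<le> icoeff p x * icoeff p y"
  by (auto simp: log_concave_def)

text \<open>With the sum fixed, the outer pair \<open>w\<close>, \<open>z\<close> is reached from
  the inner pair by moving both ends outward one step at a time.\<close>

lemma log_concaveI:
  assumes step: "\<And>m n. m \<le> n \<Longrightarrow> icoeff p (m - 1) * icoeff p (n + 1) \<le> icoeff p m * icoeff p n"
  shows "log_concave p"
proof -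
  have *: "icoeff p (m - int d) * icoeff p (n + int d) \<le> icoeff p m * icoeff p n" if "m \<le> n" for m n d
  proof (induction d)
    case (Suc d)
    have "icoeff p (m - int (Suc d)) * icoeff p (n + int (Suc d))
          \<le> icoeff p (m - int d) * icoeff p (n + int d)"
      using step[of "m - int d" "n + int d"] that by (simp add: algebra_simps)
    then show ?case
      using Suc by linarith
  qed simp
  show ?thesis
    unfolding log_concave_def
  proof (intro allI impI)
    fix w x y z :: int
    assume a: "w \<le> x" "w \<le> y" "w + z = x + y"
    then have z: "z = y + (x - w)" "z = x + (y - w)"
      by auto
    show "icoeff p w * icoeff p z \<le> icoeff p x * icoeff p y"
    proof (cases "x \<le> y")
      case True
      then show ?thesis
        using *[of x y "nat (x - w)"] a(1) z(1) by simp
    next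
      case False
      then show ?thesis
        using *[of y x "nat (y - w)"] a(2) z(2) by (simp add: mult.commute)
    qed
  qed
qed

lemma icoeff_linear_mult:
  "icoeff ([:a, 1:] * p) k = a * icoeff p k + icoeff p (k - 1)"
proof (cases "k \<le> 0")
  case True
  then show ?thesis
    by (cases "k = 0") (auto simp: icoeff_def)
next
  case False
  then obtain n where "k = int (Suc n)"
    by (metis not_le zero_less_imp_eq_int Suc_pred')
  then show ?thesis
    by (simp add: icoeff_def nat_add_distrib)
qed

lemma icoeff_quadratic_mult:
  "icoeff ([:b, a, 1:] * p) k = b * icoeff p k + a * icoeff p (k - 1) + icoeff p (k - 2)"
proof -
  have "[:b, a, 1:] * p = smult b p + [:0, 1:] * ([:a, 1:] * p)"
    by (simp add: algebra_simps)
  moreover have "icoeff (smult b p + q) k = b * icoeff p k + icoeff q k" for q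
    by (simp add: icoeff_def)
  ultimately show ?thesis
    by (simp add: icoeff_linear_mult del: mult_pCons_left)
qed

text \<open>With \<open>A = icoeff p\<close>, the product \<open>a * A (m-1) * A n\<close> occurs on
  both sides after expansion; the rest are instances of log-concavity weighted by
  \<open>a\<^sup>2\<close>, \<open>a\<close> and 1.\<close>

lemma log_concave_linear_mult:
  assumes p: "log_concave p" and a: "a \<ge> 0"
  shows "log_concave ([:a, 1:] * p)"
proof (rule log_concaveI, unfold icoeff_linear_mult)
  fix m n :: int
  assume mn: "m \<le> n"
  let ?A = "icoeff p"
  note T = log_concaveD[OF p]
  have 1: "a\<^sup>2 * (?A (m-1) * ?A (n+1)) \<le> a\<^sup>2 * (?A m * ?A n)"
    by (intro mult_left_mono T) (use mn in auto)
  have 2: "a * (?A (m-2) * ?A (n+1)) \<le> a * (?A m * ?A (n-1))"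
    by (intro mult_left_mono T) (use mn a in auto)
  have 3: "?A (m-2) * ?A n \<le> ?A (m-1) * ?A (n-1)"
    by (intro T) (use mn in auto)
  show "(a * ?A (m-1) + ?A (m-1-1)) * (a * ?A (n+1) + ?A (n+1-1))
      \<le> (a * ?A m + ?A (m-1)) * (a * ?A n + ?A (n-1))"
    using 1 2 3 by (simp add: algebra_simps power2_eq_square)
qed

text \<open>After expansion all terms pair up with the right sign except
  \<open>- b * (A (m-1) * A (n-1) - A (m-2) * A n)\<close>, where \<open>A = icoeff p\<close>. The
  same bracket occurs with weight \<open>a\<^sup>2\<close>, which absorbs it because
  \<open>b \<le> a\<^sup>2\<close>.\<close>

lemma log_concave_quadratic_mult:
  assumes p: "log_concave p" and a: "a \<ge> 0" and b: "b \<ge> 0" and ab: "b \<le> a\<^sup>2"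
  shows "log_concave ([:b, a, 1:] * p)"
proof (rule log_concaveI, unfold icoeff_quadratic_mult)
  fix m n :: int
  assume mn: "m \<le> n"
  let ?A = "icoeff p"
  note T = log_concaveD[OF p]
  have 1: "b\<^sup>2 * (?A (m-1) * ?A (n+1)) \<le> b\<^sup>2 * (?A m * ?A n)"
    by (intro mult_left_mono T) (use mn in auto)
  have 2: "?A (m-3) * ?A (n-1) \<le> ?A (m-2) * ?A (n-2)"
    by (intro T) (use mn in auto)
  have 3: "(a * b) * (?A (m-2) * ?A (n+1)) \<le> (a * b) * (?A m * ?A (n-1))"
    by (intro mult_left_mono T) (use mn a b in auto)
  have 4: "a * (?A (m-3) * ?A n) \<le> a * (?A (m-1) * ?A (n-2))"
    by (intro mult_left_mono T) (use mn a in auto)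
  have 5: "b * (?A (m-3) * ?A (n+1)) \<le> b * (?A m * ?A (n-2))"
    by (intro mult_left_mono T) (use mn b in auto)
  have "?A (m-2) * ?A n \<le> ?A (m-1) * ?A (n-1)"
    by (intro T) (use mn in auto)
  then have 6: "b * (?A (m-1) * ?A (n-1) - ?A (m-2) * ?A n)
      \<le> a\<^sup>2 * (?A (m-1) * ?A (n-1) - ?A (m-2) * ?A n)"
    using ab by (intro mult_right_mono) auto
  have "(b * ?A m + a * ?A (m-1) + ?A (m-2)) * (b * ?A n + a * ?A (n-1) + ?A (n-2))
      - (b * ?A (m-1) + a * ?A (m-2) + ?A (m-3)) * (b * ?A (n+1) + a * ?A n + ?A (n-1))
     = (b\<^sup>2 * (?A m * ?A n) - b\<^sup>2 * (?A (m-1) * ?A (n+1)))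
     + (?A (m-2) * ?A (n-2) - ?A (m-3) * ?A (n-1))
     + ((a * b) * (?A m * ?A (n-1)) - (a * b) * (?A (m-2) * ?A (n+1)))
     + (a * (?A (m-1) * ?A (n-2)) - a * (?A (m-3) * ?A n))
     + (b * (?A m * ?A (n-2)) - b * (?A (m-3) * ?A (n+1)))
     + (a\<^sup>2 * (?A (m-1) * ?A (n-1) - ?A (m-2) * ?A n)
        - b * (?A (m-1) * ?A (n-1) - ?A (m-2) * ?A n))"
    by (simp add: algebra_simps power2_eq_square)
  then have "(b * ?A (m-1) + a * ?A (m-2) + ?A (m-3)) * (b * ?A (n+1) + a * ?A n + ?A (n-1))
     \<le> (b * ?A m + a * ?A (m-1) + ?A (m-2)) * (b * ?A n + a * ?A (n-1) + ?A (n-2))"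
    using 1 2 3 4 5 6 by linarith
  then show "(b * ?A (m-1) + a * ?A (m-1-1) + ?A (m-1-2))
       * (b * ?A (n+1) + a * ?A (n+1-1) + ?A (n+1-2))
      \<le> (b * ?A m + a * ?A (m-1) + ?A (m-2)) * (b * ?A n + a * ?A (n-1) + ?A (n-2))"
    by (simp add: algebra_simps)
qed

section \<open>Real polynomials without roots in the sector\<close>

lemma Re_le_of_not_in_sector:
  assumes "z \<notin> sector (2 * pi / 3)"
  shows "Re z \<le> - cmod z / 2"
proof (cases "z = 0")
  case False
  then have "2 * pi / 3 \<le> \<bar>Arg z\<bar>"
    using assms by (auto simp: sector_def)
  moreover have "\<bar>Arg z\<bar> \<le> pi"
    using Arg_bounded[of z] by auto
  ultimately have "cos \<bar>Arg z\<bar> \<le> cos (2 * pi / 3)"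
    by (intro cos_monotone_0_pi_le) auto
  then have "cos (Arg z) \<le> - 1 / 2"
    by (simp add: cos_120)
  moreover have "Re z = cmod z * cos (Arg z)"
    using cos_Arg by (metis False nonzero_mult_div_cancel_left norm_eq_zero times_divide_eq_right)
  moreover have "cmod z * cos (Arg z) \<le> cmod z * (- 1 / 2)"
    using calculation(1) by (intro mult_left_mono) auto
  ultimately show ?thesis
    by simp
qed simp

lemma map_poly_of_real_mult:
  "map_poly (of_real :: real \<Rightarrow> complex) (p * q) = map_poly of_real p * map_poly of_real q"
  by (rule poly_eqI) (simp add: coeff_map_poly coeff_mult)

lemma map_poly_of_real_add:
  "map_poly (of_real :: real \<Rightarrow> complex) (p + q) = map_poly of_real p + map_poly of_real q"
  by (rule poly_eqI) (simp add: coeff_map_poly)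

text \<open>Division leaves a real remainder of degree at most 1 that vanishes at the nonreal
  \<open>z\<close>, hence is zero.\<close>

lemma quadratic_dvd_of_nonreal_root:
  fixes p :: "real poly"
  assumes "poly (map_poly of_real p) z = 0" "Im z \<noteq> 0"
  shows "[:(cmod z)\<^sup>2, - 2 * Re z, 1:] dvd p"
proof -
  let ?q = "[:(cmod z)\<^sup>2, - 2 * Re z, 1:]"
  let ?r = "p mod ?q"
  have "degree ?r < 2"
    using degree_mod_less'[of ?q p] by (cases "?r = 0") auto
  then have r: "?r = [:coeff ?r 0, coeff ?r 1:]"
    by (intro poly_eqI) (auto simp: coeff_pCons coeff_eq_0 split: nat.splits)
  have "z * z = complex_of_real (2 * Re z) * z - complex_of_real ((cmod z)\<^sup>2)"
    unfolding cmod_power2 by (simp add: complex_eq_iff power2_eq_square)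
  then have q0: "poly (map_poly of_real ?q) z = 0"
    by (simp add: map_poly_pCons algebra_simps)
  have "p = ?q * (p div ?q) + ?r"
    by (rule mult_div_mod_eq[symmetric])
  then have "poly (map_poly of_real p) z
      = poly (map_poly of_real ?q) z * poly (map_poly of_real (p div ?q)) z + poly (map_poly of_real ?r) z"
    by (metis map_poly_of_real_add map_poly_of_real_mult poly_add poly_mult)
  then have "poly (map_poly of_real ?r) z = 0"
    using assms(1) q0 by simp
  then have "of_real (coeff ?r 0) + z * of_real (coeff ?r 1) = 0"
    by (subst (asm) r) (simp add: map_poly_pCons)
  then have "coeff ?r 1 = 0" "coeff ?r 0 = 0"
    using assms(2) by (auto simp: complex_eq_iff)
  then have "?r = 0"
    using r by simp
  then show ?thesis
    by auto
qed

theorem log_concave_if_sector_nonvanishing: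
  fixes p :: "real poly"
  assumes "\<And>z. z \<in> sector (2 * pi / 3) \<Longrightarrow> poly (map_poly of_real p) z \<noteq> 0"
  shows "log_concave p"
  using assms
proof (induction "degree p" arbitrary: p rule: less_induct)
  case less
  have "1 \<in> sector (2 * pi / 3)"
    by (simp add: sector_def)
  then have "p \<noteq> 0"
    using less.prems by fastforce
  show ?case
  proof (cases "degree p = 0")
    case True
    then obtain c where "p = [:c:]"
      by (metis degree_eq_zeroE)
    then have "icoeff p k = (if k = 0 then c else 0)" for k
      by (auto simp: icoeff_def coeff_pCons split: nat.splits)
    then show ?thesis
      by (intro log_concaveI) auto
  next
    case False
    then have "\<not> constant (poly (map_poly complex_of_real p))"
      by (simp add: constant_degree degree_map_poly)
    then obtain z where z: "poly (map_poly complex_of_real p) z = 0"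
      using fundamental_theorem_of_algebra by blast
    then have Re_z: "Re z \<le> - cmod z / 2"
      using less.prems Re_le_of_not_in_sector by blast
    show ?thesis
    proof (cases "Im z = 0")
      case True
      then have "z = of_real (Re z)"
        by (simp add: complex_eq_iff)
      moreover have "poly (map_poly of_real p) (of_real x) = complex_of_real (poly p x)" for x
        by (induction p) (auto simp: map_poly_pCons)
      ultimately have "poly p (Re z) = 0"
        using z by (metis of_real_0 of_real_eq_iff)
      then obtain q where p: "p = [:- Re z, 1:] * q"
        by (auto simp: poly_eq_0_iff_dvd)
      have "degree q < degree p"
        using \<open>p \<noteq> 0\<close> unfolding p by (subst degree_mult_eq) auto
      moreover have "poly (map_poly of_real q) w \<noteq> 0" if "w \<in> sector (2 * pi / 3)" for w
        using less.prems[OF that] by (auto simp: p map_poly_of_real_mult simp del: mult_pCons_left)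
      ultimately have "log_concave q"
        using less.hyps by blast
      moreover have "- Re z \<ge> 0"
        using Re_z norm_ge_zero[of z] by linarith
      ultimately show ?thesis
        unfolding p by (rule log_concave_linear_mult)
    next
      case nonreal: False
      obtain q where p: "p = [:(cmod z)\<^sup>2, - 2 * Re z, 1:] * q"
        using quadratic_dvd_of_nonreal_root[OF z nonreal] by (elim dvdE)
      have "degree q < degree p"
        using \<open>p \<noteq> 0\<close> unfolding p by (subst degree_mult_eq) auto
      moreover have "poly (map_poly of_real q) w \<noteq> 0" if "w \<in> sector (2 * pi / 3)" for w
        using less.prems[OF that] by (auto simp: p map_poly_of_real_mult simp del: mult_pCons_left)
      ultimately have "log_concave q"
        using less.hyps by blast
      \<comment> \<open>Squared, this is \<open>b \<le> a\<^sup>2\<close> for the conjugate pair of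
        roots; the angle \<open>2 * pi / 3\<close> enters through its cosine
        \<open>- 1 / 2\<close>.\<close>
      moreover have "cmod z \<le> - 2 * Re z"
        using Re_z by simp
      moreover from this have "- 2 * Re z \<ge> 0"
        using norm_ge_zero[of z] by linarith
      moreover have "(cmod z)\<^sup>2 \<le> (- 2 * Re z)\<^sup>2"
        using calculation(2) by (intro power_mono) auto
      ultimately show ?thesis
        unfolding p by (intro log_concave_quadratic_mult) auto
    qed
  qed
qed

section \<open>Vertex and edge factors\<close>

definition vertex_poly :: "nat \<Rightarrow> nat \<Rightarrow> real poly" where
  "vertex_poly a b = [:1, 1:] ^ b * [:1, sqrt 3, 1:] ^ a"

lemma degree_vertex_poly: "degree (vertex_poly a b) = 2 * a + b"
  unfolding vertex_poly_def by (subst degree_mult_eq) (auto simp: degree_power_eq)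

text \<open>This is \<open>z ^ m * vertex_poly a b (s / z)\<close> as a polynomial in \<open>z\<close>, where \<open>m = 2 * a + b\<close>.\<close>

definition homogenized_vertex_poly :: "nat \<Rightarrow> nat \<Rightarrow> complex \<Rightarrow> complex poly" where
  "homogenized_vertex_poly a b s =
    (\<Sum>i\<le>2 * a + b. monom (of_real (coeff (vertex_poly a b) i) * s ^ i) (2 * a + b - i))"

lemma coeff_homogenized_vertex_poly:
  "coeff (homogenized_vertex_poly a b s) k =
    (if k \<le> 2 * a + b
     then of_real (coeff (vertex_poly a b) (2 * a + b - k)) * s ^ (2 * a + b - k) else 0)"
proof -
  let ?m = "2 * a + b"
  have "coeff (homogenized_vertex_poly a b s) k =
      (\<Sum>i\<le>?m. if i = ?m - k then (if k \<le> ?m then of_real (coeff (vertex_poly a b) i) * s ^ i else 0) else 0)"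
    unfolding homogenized_vertex_poly_def coeff_sum coeff_monom by (rule sum.cong) auto
  then show ?thesis
    by (simp add: sum.delta')
qed

lemma map_poly_of_real_power:
  "map_poly (of_real :: real \<Rightarrow> complex) (p ^ n) = map_poly of_real p ^ n"
  by (induction n) (simp_all add: map_poly_of_real_mult)

text \<open>The roots of \<open>1 + sqrt 3 * y + y\<^sup>2\<close> are \<open>- cis (pi / 6)\<close>
  and \<open>- cis (- (pi / 6))\<close>, since \<open>2 * cos (pi / 6) = sqrt 3\<close>.\<close>

lemma poly_homogenized_vertex_poly:
  assumes "z \<noteq> 0"
  shows "poly (homogenized_vertex_poly a b s) z =
    (z + s) ^ b * ((z + cis (pi / 6) * s) * (z + cis (- (pi / 6)) * s)) ^ a"
proof -
  let ?m = "2 * a + b" and ?r = "map_poly complex_of_real (vertex_poly a b)"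
  have "poly (homogenized_vertex_poly a b s) z
      = (\<Sum>i\<le>?m. of_real (coeff (vertex_poly a b) i) * s ^ i * z ^ (?m - i))"
    by (simp add: homogenized_vertex_poly_def poly_sum poly_monom)
  also have "\<dots> = z ^ ?m * (\<Sum>i\<le>?m. coeff ?r i * (s / z) ^ i)"
    unfolding sum_distrib_left
    by (rule sum.cong) (use assms in \<open>auto simp: coeff_map_poly field_simps power_diff\<close>)
  also have "\<dots> = z ^ ?m * poly ?r (s / z)"
    using degree_vertex_poly[of a b]
    by (subst poly_eq_sum_of_degree_le[of _ ?m]) (auto simp: degree_map_poly)
  also have "poly ?r (s / z) = (1 + s / z) ^ b * (1 + of_real (sqrt 3) * (s / z) + (s / z)\<^sup>2) ^ a"
    by (simp add: vertex_poly_def map_poly_of_real_mult map_poly_of_real_power map_poly_pCons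
        power2_eq_square algebra_simps)
  also have "z ^ ?m * \<dots> = (z * (1 + s / z)) ^ b * (z\<^sup>2 * (1 + of_real (sqrt 3) * (s / z) + (s / z)\<^sup>2)) ^ a"
    unfolding power_add power_mult power_mult_distrib by (simp only: mult_ac)
  also have "z * (1 + s / z) = z + s"
    using assms by (simp add: field_simps)
  also have "z\<^sup>2 * (1 + of_real (sqrt 3) * (s / z) + (s / z)\<^sup>2) = z\<^sup>2 + of_real (sqrt 3) * s * z + s\<^sup>2"
    using assms by (simp add: field_simps power2_eq_square)
  also have "\<dots> = (z + cis (pi / 6) * s) * (z + cis (- (pi / 6)) * s)"
  proof -
    have "cis (pi / 6) + cis (- (pi / 6)) = of_real (sqrt 3)"
      by (simp add: complex_eq_iff cos_30)
    moreover have "cis (pi / 6) * cis (- (pi / 6)) = 1"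
      by (simp add: cis_mult)
    moreover have "(z + x * s) * (z + y * s) = z\<^sup>2 + (x + y) * s * z + (x * y) * s\<^sup>2" for x y
      by (simp add: algebra_simps power2_eq_square)
    ultimately show ?thesis
      by simp
  qed
  finally show ?thesis .
qed

text \<open>The sector of half-angle \<open>pi / 3\<close>, written as two half-planes: openness and
  convexity are immediate, and the conditions are those that keep
  \<open>z + cis (pi / 6) * s\<close> and \<open>z + cis (- (pi / 6)) * s\<close> away from
  zero.\<close>

definition half_angle_sector :: "complex set" where
  "half_angle_sector = {s. Re (cis (pi / 6) * s) > 0} \<inter> {s. Re (cis (- (pi / 6)) * s) > 0}"

lemma half_angle_sector_open_convex: "open half_angle_sector" "convex half_angle_sector"
proof -
  have *: "{s. Re (c * s) > 0} = (\<lambda>s. 0 + s * c) -` {x. Re x > 0}" for c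
    by (auto simp: mult.commute)
  show "open half_angle_sector" "convex half_angle_sector"
    unfolding half_angle_sector_def *
    by (intro open_Int convex_Int affine_vimage_open_convex
        open_halfspace_Re_gt convex_halfspace_Re_gt)+
qed

lemma Re_pos_if_half_angle_sector:
  assumes "s \<in> half_angle_sector"
  shows "Re s > 0"
proof -
  have "Re (cis (pi / 6) * s) + Re (cis (- (pi / 6)) * s) = sqrt 3 * Re s"
    by (simp add: cos_30)
  moreover have "Re (cis (pi / 6) * s) > 0" "Re (cis (- (pi / 6)) * s) > 0"
    using assms unfolding half_angle_sector_def by blast+
  ultimately have "sqrt 3 * Re s > 0"
    by linarith
  then show ?thesis
    by (simp add: zero_less_mult_iff)
qed

text \<open>The square root halves the argument, so a rotation by \<open>pi / 6\<close> either way
  stays within \<open>pi / 2\<close> of the positive axis.\<close>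

lemma csqrt_in_half_angle_sector:
  assumes "t \<in> sector (2 * pi / 3)"
  shows "csqrt t \<in> half_angle_sector"
proof -
  have t: "t \<noteq> 0" "\<bar>Arg t\<bar> < 2 * pi / 3"
    using assms by (auto simp: sector_def)
  define r where "r = cmod (csqrt t)"
  have "r > 0"
    using t by (simp add: r_def)
  have s: "csqrt t = rcis r (Arg t / 2)"
    using rcis_cmod_Arg[of "csqrt t"] by (simp add: r_def)
  have "Re (cis x * csqrt t) = r * cos (x + Arg t / 2)" for x
    unfolding s rcis_def by (simp add: cos_add algebra_simps)
  moreover have "cos (pi / 6 + Arg t / 2) > 0" "cos (- (pi / 6) + Arg t / 2) > 0"
    by (rule cos_gt_zero_pi; use t(2) in linarith)+
  ultimately show ?thesis
    using \<open>r > 0\<close> unfolding half_angle_sector_def Int_iff mem_Collect_eq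
    by (metis mult_pos_pos)
qed

lemma vertex_factor_nonvanishing:
  assumes "s \<in> half_angle_sector" "Re z > 0"
  shows "poly (homogenized_vertex_poly a b s) z \<noteq> 0"
proof -
  have ne: "z + w \<noteq> 0" if "Re w > 0" for w
    using assms(2) that by (metis add_pos_pos less_irrefl plus_complex.sel(1) zero_complex.sel(1))
  have "z \<noteq> 0"
    using assms(2) by auto
  then show ?thesis
    using ne[of s] ne[of "cis (pi / 6) * s"] ne[of "cis (- (pi / 6)) * s"]
      assms(1) Re_pos_if_half_angle_sector[OF assms(1)]
    unfolding half_angle_sector_def
    by (auto simp: poly_homogenized_vertex_poly simp del: times_complex.sel)
qed

lemma one_plus_mult_neq_0:
  assumes "Re x > 0" "Re y > 0"
  shows "1 + x * y \<noteq> 0"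
proof
  assume "1 + x * y = 0"
  then have "x * y = -1"
    by (simp add: add_eq_0_iff)
  then have xy: "Re x * Re y - Im x * Im y = -1" "Re x * Im y + Im x * Re y = 0"
    by (auto simp: complex_eq_iff)
  \<comment> \<open>The real part of the conjugate of \<open>x\<close> times \<open>x * y\<close>,
    which isolates \<open>Re y\<close>.\<close>
  have "((Re x)\<^sup>2 + (Im x)\<^sup>2) * Re y
      = Re x * (Re x * Re y - Im x * Im y) + Im x * (Re x * Im y + Im x * Re y)"
    by (simp add: algebra_simps power2_eq_square)
  then have "((Re x)\<^sup>2 + (Im x)\<^sup>2) * Re y = - Re x"
    by (simp add: xy)
  moreover have "((Re x)\<^sup>2 + (Im x)\<^sup>2) * Re y \<ge> 0"
    using assms by simp
  ultimately show False
    using assms by simp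
qed

section \<open>Degree monomials and edge factors\<close>

context multigraph
begin

text \<open>\<open>x\<close> and \<open>y\<close> are the two endpoints and coincide for a loop, so
  loops need no separate treatment later.\<close>

lemma edge_monomial:
  assumes "e \<in> edges G"
  obtains x y where "x \<in> verts G" "y \<in> verts G"
    "\<And>z :: 'v \<Rightarrow> complex. (\<Prod>v\<in>verts G. z v ^ count (ends G e) v) = z x * z y"
proof -
  obtain x y where xy: "ends G e = {#x, y#}"
    using size_ends[OF assms] unfolding numeral_2_eq_2
    by (metis One_nat_def add_mset_add_single size_1_singleton_mset size_mset_SucE)
  have "x \<in> verts G" "y \<in> verts G"
    using ends_subset[OF assms] by (auto simp: xy)
  moreover have "(\<Prod>v\<in>verts G. z v ^ count (ends G e) v) = z x * z y" for z :: "'v \<Rightarrow> complex"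
  proof -
    have "z v ^ count (ends G e) v = (if v = x then z v else 1) * (if v = y then z v else 1)" for v
      by (auto simp: xy)
    then show ?thesis
      using calculation finite_verts by (simp add: prod.distrib prod.delta)
  qed
  ultimately show thesis
    using that by blast
qed

lemma prod_power_deg_in:
  fixes z :: "'v \<Rightarrow> complex"
  shows "(\<Prod>v\<in>verts G. z v ^ deg_in G H v) = (\<Prod>e\<in>H. \<Prod>v\<in>verts G. z v ^ count (ends G e) v)"
  unfolding deg_in_def power_sum by (rule prod.swap)

text \<open>The handshake identity in multiplicative form: each edge contributes two factors
  \<open>s\<close>. This is where \<open>t = s\<^sup>2\<close> comes from.\<close>

lemma prod_power_deg_in_const:
  fixes s :: complex
  assumes "H \<subseteq> edges G"
  shows "(\<Prod>v\<in>verts G. s ^ deg_in G H v) = (s\<^sup>2) ^ card H"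
proof -
  have "(\<Prod>v\<in>verts G. s ^ count (ends G e) v) = s\<^sup>2" if "e \<in> H" for e
  proof -
    have "e \<in> edges G"
      using assms that by blast
    then show ?thesis
    proof (rule edge_monomial)
      fix x y
      assume "\<And>z :: 'v \<Rightarrow> complex. (\<Prod>v\<in>verts G. z v ^ count (ends G e) v) = z x * z y"
      from this[of "\<lambda>_. s"] show ?thesis
        by (simp add: power2_eq_square)
    qed
  qed
  then show ?thesis
    unfolding prod_power_deg_in by simp
qed

lemma deg_in_le_deg: "H \<subseteq> edges G \<Longrightarrow> deg_in G H v \<le> deg G v"
  unfolding deg_in_def deg_def by (intro sum_mono2 finite_edges) auto

text \<open>The sum over subgraphs is the expanded product over edges of
  \<open>1 + z x * z y\<close>, and no such factor vanishes.\<close>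

lemma edge_factors_nonvanishing:
  fixes z :: "'v \<Rightarrow> complex"
  assumes "\<And>v. v \<in> verts G \<Longrightarrow> Re (z v) > 0"
  shows "(\<Sum>H\<in>Pow (edges G). \<Prod>v\<in>verts G. z v ^ deg_in G H v) \<noteq> 0"
proof -
  have "(\<Sum>H\<in>Pow (edges G). \<Prod>v\<in>verts G. z v ^ deg_in G H v)
      = (\<Prod>e\<in>edges G. (\<Prod>v\<in>verts G. z v ^ count (ends G e) v) + 1)"
    unfolding prod_power_deg_in prod_add[OF finite_edges] by simp
  moreover have "(\<Prod>v\<in>verts G. z v ^ count (ends G e) v) + 1 \<noteq> 0" if e: "e \<in> edges G" for e
  proof -
    obtain x y where "x \<in> verts G" "y \<in> verts G"
      "(\<Prod>v\<in>verts G. z v ^ count (ends G e) v) = z x * z y"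
      using edge_monomial[OF e] by metis
    then show ?thesis
      using one_plus_mult_neq_0[of "z x" "z y"] assms by (simp add: add.commute)
  qed
  ultimately show ?thesis
    using finite_edges by simp
qed

lemma poly_N_poly:
  "poly (N_poly G u) t = (\<Sum>H\<in>Pow (edges G). of_real (u_deg G u H) * t ^ card H)"
proof -
  have "poly (N_poly G u) t
      = (\<Sum>j\<le>card (edges G). \<Sum>H | H \<in> Pow (edges G) \<and> card H = j. of_real (u_deg G u H) * t ^ card H)"
    by (simp add: N_poly_def N_def poly_sum poly_monom sum_distrib_right)
  also have "\<dots> = (\<Sum>H\<in>Pow (edges G). of_real (u_deg G u H) * t ^ card H)"
    by (rule sum.group) (auto simp: finite_edges card_mono)
  finally show ?thesis .
qed

end

section \<open>Assembly for the graph and its subgraph counts\<close>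

theorem theorem26:
  fixes G :: "('v, 'e) mgraph"
    and f g a b :: "'v \<Rightarrow> nat"
    and u :: "'v \<Rightarrow> nat \<Rightarrow> real"
  assumes "multigraph G"
    and "\<And>v. v \<in> verts G \<Longrightarrow> f v \<le> g v \<and> g v \<le> deg G v"
    and "\<And>v. v \<in> verts G \<Longrightarrow> g v - f v = 2 * a v + b v \<and> b v \<le> 1"
    and "\<And>v k. v \<in> verts G \<Longrightarrow> 0 \<le> u v k"
    and "\<And>v. v \<in> verts G \<Longrightarrow>
           \<Gamma> (deg G v) (u v) = coeffwise_prod ([:1, 1:] ^ deg G v) (q_poly (f v) (a v) (b v))"
  shows "sector_nonvanishing (2 * pi / 3) (N_poly G u)
       \<and> (\<forall>j\<ge>1. (N G u j)\<^sup>2 \<ge> N G u (j - 1) * N G u (j + 1))"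
proof -
  interpret multigraph G by fact
  let ?V = "verts G" and ?E = "edges G"
  \<comment> \<open>For a fixed subgraph \<open>H\<close> the summand splits over the vertices; this
    is the factor at \<open>v\<close>.\<close>
  define R where "R = (\<lambda>H v s. monom 1 (deg_in G H v) * homogenized_vertex_poly (a v) (b v) s)"
  have coeff_R: "coeff (R H v s) k = (if deg_in G H v \<le> k
      then coeff (homogenized_vertex_poly (a v) (b v) s) (k - deg_in G H v) else 0)" for H v s k
    by (simp add: R_def coeff_monom_mult)
  have dichotomy: "(\<forall>s\<in>half_angle_sector. \<forall>z. (\<forall>v\<in>?V. Re (z v) > 0) \<longrightarrow> extracted (Pow ?E) ?V R g ?V s z = 0)
    \<or> (\<forall>s\<in>half_angle_sector. \<forall>z. (\<forall>v\<in>?V. Re (z v) > 0) \<longrightarrow> extracted (Pow ?E) ?V R g ?V s z \<noteq> 0)"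
  proof (rule extract_zero_or_nonvanishing)
    show "finite (Pow ?E)" "finite ?V"
      by (simp_all add: finite_edges finite_verts)
    show "degree (R H v s) \<le> deg_in G H v + (2 * a v + b v)" for H v s
      by (rule degree_le) (auto simp: coeff_R coeff_homogenized_vertex_poly)
    show "(\<lambda>s. coeff (R H v s) k) holomorphic_on half_angle_sector" for H v k
      unfolding coeff_R coeff_homogenized_vertex_poly
      by (cases "deg_in G H v \<le> k"; cases "k - deg_in G H v \<le> 2 * a v + b v")
        (auto intro!: holomorphic_intros)
    show "extracted (Pow ?E) ?V R g {} s z \<noteq> 0"
      if "s \<in> half_angle_sector" "\<And>v. v \<in> ?V \<Longrightarrow> Re (z v) > 0" for s z
    proof -
      \<comment> \<open>Before any extraction the vertex factors do not depend on \<open>H\<close>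
        and can be pulled out of the sum.\<close>
      have "extracted (Pow ?E) ?V R g {} s z
          = (\<Prod>v\<in>?V. poly (homogenized_vertex_poly (a v) (b v) s) (z v))
            * (\<Sum>H\<in>Pow ?E. \<Prod>v\<in>?V. z v ^ deg_in G H v)"
        by (simp add: extracted_def R_def poly_monom prod.distrib sum_distrib_left mult.commute)
      then show ?thesis
        using edge_factors_nonvanishing[of z] vertex_factor_nonvanishing[OF that(1)] that(2) finite_verts
        by simp
    qed
  qed (auto intro: half_angle_sector_open_convex)
  \<comment> \<open>The weight \<open>s ^ f v\<close> at each vertex turns the power
    \<open>s ^ (k - f v)\<close> left by the extraction into \<open>s ^ k\<close>, where
    \<open>k\<close> is the degree of \<open>v\<close> in \<open>H\<close>.\<close>
  have extract_V: "s ^ sum f ?V * extracted (Pow ?E) ?V R g ?V s z = poly (N_poly G u) (s\<^sup>2)" for s z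
  proof -
    have u: "s ^ f v * coeff (R H v s) (g v) = of_real (u v (deg_in G H v)) * s ^ deg_in G H v"
      if "H \<subseteq> ?E" "v \<in> ?V" for H v
    proof -
      define k where "k = deg_in G H v"
      have "u v k = coeff (q_poly (f v) (a v) (b v)) k"
        using assms(5)[OF that(2)] deg_in_le_deg[OF that(1), of v]
        by (simp add: \<Gamma>_eq_coeffwise_prod_iff k_def)
      also have "\<dots> = (if f v \<le> k then coeff (vertex_poly (a v) (b v)) (k - f v) else 0)"
        by (simp add: q_poly_def vertex_poly_def coeff_monom_mult mult.assoc)
      finally have u: "u v k = (if f v \<le> k then coeff (vertex_poly (a v) (b v)) (k - f v) else 0)" .
      have fg: "g v = f v + (2 * a v + b v)"
        using assms(2,3)[OF that(2)] by auto
      \<comment> \<open>In both outer cases the two sides are zero: the extraction index or the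
        index into \<open>vertex_poly\<close> is out of range.\<close>
      consider "k < f v" | "f v \<le> k" "k \<le> g v" | "g v < k"
        by linarith
      then show ?thesis
        unfolding coeff_R coeff_homogenized_vertex_poly k_def[symmetric] u
      proof cases
        case 2
        then have "2 * a v + b v - (g v - k) = k - f v" "g v - k \<le> 2 * a v + b v"
          using fg by auto
        moreover have "s ^ f v * s ^ (k - f v) = s ^ k"
          using 2 by (simp flip: power_add)
        ultimately show "s ^ f v * (if k \<le> g v then if g v - k \<le> 2 * a v + b v then
            of_real (coeff (vertex_poly (a v) (b v)) (2 * a v + b v - (g v - k))) * s ^ (2 * a v + b v - (g v - k)) else 0 else 0)
            = of_real (if f v \<le> k then coeff (vertex_poly (a v) (b v)) (k - f v) else 0) * s ^ k"
          using 2 by (simp add: mult_ac)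
      qed (auto simp: fg degree_vertex_poly coeff_eq_0)
    qed
    have "s ^ sum f ?V * extracted (Pow ?E) ?V R g ?V s z
        = (\<Sum>H\<in>Pow ?E. \<Prod>v\<in>?V. s ^ f v * coeff (R H v s) (g v))"
      by (simp add: extracted_def power_sum prod.distrib sum_distrib_left)
    also have "\<dots> = (\<Sum>H\<in>Pow ?E. \<Prod>v\<in>?V. of_real (u v (deg_in G H v)) * s ^ deg_in G H v)"
      by (intro sum.cong prod.cong refl u) auto
    also have "\<dots> = poly (N_poly G u) (s\<^sup>2)"
      by (simp add: poly_N_poly prod.distrib prod_power_deg_in_const u_deg_def)
    finally show ?thesis .
  qed
  have nonvanishing: "N_poly G u = 0 \<or> (\<forall>t\<in>sector (2 * pi / 3). poly (N_poly G u) t \<noteq> 0)"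
    using dichotomy
  proof
    assume zero: "\<forall>s\<in>half_angle_sector. \<forall>z. (\<forall>v\<in>?V. Re (z v) > 0) \<longrightarrow> extracted (Pow ?E) ?V R g ?V s z = 0"
    \<comment> \<open>Vanishing on the positive axis already forces the zero polynomial; the
      constant 1 serves as an arbitrary point of the half-plane.\<close>
    have "poly (N_poly G u) (of_real x) = 0" if "x > 0" for x
    proof -
      have "csqrt (of_real x) \<in> half_angle_sector"
        using that by (intro csqrt_in_half_angle_sector) (simp add: sector_def)
      then show ?thesis
        using extract_V[of "csqrt (of_real x)" "\<lambda>_. 1"] zero by simp
    qed
    then show ?thesis
      using poly_eq_0_if_zero_on_positive_reals by blast
  next
    assume nonzero: "\<forall>s\<in>half_angle_sector. \<forall>z. (\<forall>v\<in>?V. Re (z v) > 0) \<longrightarrow> extracted (Pow ?E) ?V R g ?V s z \<noteq> 0"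
    have "poly (N_poly G u) t \<noteq> 0" if "t \<in> sector (2 * pi / 3)" for t
    proof -
      have "csqrt t \<noteq> 0"
        using that by (simp add: sector_def)
      then show ?thesis
        using extract_V[of "csqrt t" "\<lambda>_. 1"] nonzero csqrt_in_half_angle_sector[OF that]
        by (metis mult_eq_0_iff one_complex.sel(1) power2_csqrt power_not_zero zero_less_one)
    qed
    then show ?thesis
      by blast
  qed
  define p where "p = (\<Sum>j\<le>card ?E. monom (N G u j) j)"
  have map_p: "map_poly of_real p = N_poly G u"
    by (rule poly_eqI) (simp add: p_def N_poly_def coeff_map_poly coeff_sum if_distrib cong: if_cong)
  have coeff_p: "coeff p j = N G u j" for j
    using coeff_N_poly[OF finite_edges, of u j] by (simp add: coeff_map_poly flip: map_p)
  have "log_concave p"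
  \<comment> \<open>The factorization into roots needs a nonzero polynomial, so the zero alternative
    is treated directly.\<close>
  proof (cases "N_poly G u = 0")
    case True
    then have "coeff p j = 0" for j
      using coeff_N_poly[OF finite_edges, of u j] by (simp add: coeff_p)
    then show ?thesis
      by (simp add: log_concave_def icoeff_def)
  next
    case False
    then show ?thesis
      using nonvanishing by (intro log_concave_if_sector_nonvanishing) (simp add: map_p)
  qed
  then have "N G u (j - 1) * N G u (j + 1) \<le> (N G u j)\<^sup>2" if "j \<ge> 1" for j
    using log_concaveD[of p "int j - 1" "int j" "int j" "int j + 1"] that
    by (simp add: icoeff_def coeff_p power2_eq_square nat_diff_distrib nat_add_distrib)
  then show ?thesis
    using nonvanishing by (auto simp: sector_nonvanishing_def)
qed

end
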